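(* Let $a\neq 0$ and $b$ be constants. The general solution of the second-order ordinary differential equation $$X Y'' = \frac{b}{3a}+\frac{b^3}{27a^2}+\left(1+\frac{b^2}{3a}\right)Y' + b\,(Y')^2 + a\,(Y')^3,\qquad Y=Y(X),$$ is $$a\,Y^2+\frac{2b}{3}\,XY+\left(1+\frac{b^2}{9a}\right)X^2+J_2\left(Y+\frac{b}{3a}X\right)+J_1=0,$$ where $J_1 = e^{b}(B-1)+1$ and $J_2 = A\,e^{b/2}$, and $A$, $B$ are the constants in the solution $a\,\widetilde Y^2+A\,\widetilde Y+\widetilde X^2+B=0$ of the equation $\widetilde X\,\widetilde Y''=\widetilde Y'+a\,(\widetilde Y')^3$, $\widetilde Y=\widetilde Y(\widetilde X)$.
   Context: Primes denote derivatives with respect to the independent variable ($X$ for $Y$, $\widetilde X$ for $\widetilde Y$). The solution is obtained from that of the equation for $\widetilde Y$ via the point transformation $\widetilde X=\sqrt{e^{-b}(1+X^2)-1}$, $\widetilde Y=e^{-b/2}\left(Y+\frac{b}{3a}X\right)$. The constants $A$ and $B$ are $A=\frac{2\gamma}{m}\left(c-\frac{\delta}{\lambda}\right)$ and $B=\frac{1}{\lambda m}$, where $m$ and $c$ are the constants in the solution $W=mZ+c$ of the free particle equation $W''=0$, $W=W(Z)$, and $\gamma,\lambda,\delta$ are arbitrary constants with $\lambda\gamma\neq0$ appearing in the point transformation $Z=\frac{a\widetilde Y^2+\widetilde X^2}{2\gamma\widetilde Y}$, $W=\frac{\delta}{\lambda}-\frac{1}{2\gamma\lambda\widetilde Y}$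 between the equation for $\widetilde Y$ and the free particle equation. *)

theory Defs
  imports "HOL-Analysis.Analysis"
begin

definition open_interval :: "real set \<Rightarrow> bool" where
  "open_interval I \<longleftrightarrow> open I \<and> is_interval I \<and> I \<noteq> {}"

definition twice_differentiable_on :: "(real \<Rightarrow> real) \<Rightarrow> real set \<Rightarrow> bool" where
  "twice_differentiable_on Y I \<longleftrightarrow>
     (\<forall>x\<in>I. Y differentiable (at x) \<and> deriv Y differentiable (at x))"

text \<open>A second-order equation is a relation \<open>F X Y Y' Y''\<close> between the independent variable,
  the unknown and its first two derivatives.\<close>

definition solves_ode2 ::
  "(real \<Rightarrow> real \<Rightarrow> real \<Rightarrow> real \<Rightarrow> bool) \<Rightarrow> real set \<Rightarrow> (real \<Rightarrow> real) \<Rightarrow> bool" where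
  "solves_ode2 F I Y \<longleftrightarrow> open_interval I \<and> twice_differentiable_on Y I \<and>
     (\<forall>x\<in>I. F x (Y x) (deriv Y x) (deriv (deriv Y) x))"

definition implicit_on ::
  "(real \<Rightarrow> real \<Rightarrow> real) \<Rightarrow> real set \<Rightarrow> (real \<Rightarrow> real) \<Rightarrow> bool" where
  "implicit_on \<phi> I Y \<longleftrightarrow> (\<forall>x\<in>I. \<phi> x (Y x) = 0)"

text \<open>\<open>\<Phi> A B X Y = 0\<close> is the general solution of \<open>F\<close>, with arbitrary constants \<open>A\<close>, \<open>B\<close>:
  every twice differentiable function given implicitly by the relation is a solution;
  every solution on an open interval satisfies the relation for exactly one choice of the
  constants, unless it is one of the exceptional (singular) solutions in \<open>E\<close>;
  and the constants can be fitted to all initial data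
  \<open>(X\<^sub>0, Y(X\<^sub>0), Y'(X\<^sub>0))\<close> in \<open>D\<close>.
  The exceptional set is needed because, as usual for nonlinear equations, a two-parameter general
  solution may omit a lower-dimensional set of solutions.\<close>

definition general_solution ::
  "(real \<Rightarrow> real \<Rightarrow> real \<Rightarrow> real \<Rightarrow> bool) \<Rightarrow> (real \<Rightarrow> real \<Rightarrow> real \<Rightarrow> real \<Rightarrow> real)
     \<Rightarrow> (real \<Rightarrow> real) set \<Rightarrow> (real \<times> real \<times> real) set \<Rightarrow> bool" where
  "general_solution F \<Phi> E D \<longleftrightarrow>
     (\<forall>I Y A B. open_interval I \<longrightarrow> twice_differentiable_on Y I \<longrightarrow>
        implicit_on (\<Phi> A B) I Y \<longrightarrow> solves_ode2 F I Y) \<and>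
     (\<forall>I Y. solves_ode2 F I Y \<longrightarrow> \<not> (\<exists>g\<in>E. \<forall>x\<in>I. Y x = g x) \<longrightarrow>
        (\<exists>!p. case p of (A, B) \<Rightarrow> implicit_on (\<Phi> A B) I Y)) \<and>
     (\<forall>(x0, y0, p0)\<in>D. \<exists>A B I Y. open_interval I \<and> x0 \<in> I \<and> twice_differentiable_on Y I \<and>
        implicit_on (\<Phi> A B) I Y \<and> Y x0 = y0 \<and> deriv Y x0 = p0)"

definition ode :: "real \<Rightarrow> real \<Rightarrow> real \<Rightarrow> real \<Rightarrow> real \<Rightarrow> real \<Rightarrow> bool" where
  "ode a b X Y Y1 Y2 \<longleftrightarrow>
     X * Y2 = b / (3 * a) + b ^ 3 / (27 * a ^ 2) + (1 + b ^ 2 / (3 * a)) * Y1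
                + b * Y1 ^ 2 + a * Y1 ^ 3"

definition ode_tilde :: "real \<Rightarrow> real \<Rightarrow> real \<Rightarrow> real \<Rightarrow> real \<Rightarrow> bool" where
  "ode_tilde a X Y Y1 Y2 \<longleftrightarrow> X * Y2 = Y1 + a * Y1 ^ 3"

definition J1 :: "real \<Rightarrow> real \<Rightarrow> real" where
  "J1 b B = exp b * (B - 1) + 1"

definition J2 :: "real \<Rightarrow> real \<Rightarrow> real" where
  "J2 b A = A * exp (b / 2)"

definition sol :: "real \<Rightarrow> real \<Rightarrow> real \<Rightarrow> real \<Rightarrow> real \<Rightarrow> real \<Rightarrow> real" where
  "sol a b A B X Y =
     a * Y ^ 2 + 2 * b / 3 * X * Y + (1 + b ^ 2 / (9 * a)) * X ^ 2
       + J2 b A * (Y + b / (3 * a) * X) + J1 b B"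

definition sol_tilde :: "real \<Rightarrow> real \<Rightarrow> real \<Rightarrow> real \<Rightarrow> real \<Rightarrow> real" where
  "sol_tilde a A B X Y = a * Y ^ 2 + A * Y + X ^ 2 + B"

text \<open>The point transformation from the equation \<^const>\<open>ode\<close> to \<^const>\<open>ode_tilde\<close>.\<close>

definition X_tilde :: "real \<Rightarrow> real \<Rightarrow> real" where
  "X_tilde b X = sqrt (exp (- b) * (1 + X ^ 2) - 1)"

definition Y_tilde :: "real \<Rightarrow> real \<Rightarrow> real \<Rightarrow> real \<Rightarrow> real" where
  "Y_tilde a b X Y = exp (- b / 2) * (Y + b / (3 * a) * X)"

text \<open>The point transformation from \<^const>\<open>ode_tilde\<close> to the free particle equation \<open>W'' = 0\<close>,
  and the constants \<open>A\<close>, \<open>B\<close> coming from its solution \<open>W = m Z + c\<close>.\<close>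

definition Z_free :: "real \<Rightarrow> real \<Rightarrow> real \<Rightarrow> real \<Rightarrow> real" where
  "Z_free a \<gamma> X Y = (a * Y ^ 2 + X ^ 2) / (2 * \<gamma> * Y)"

definition W_free :: "real \<Rightarrow> real \<Rightarrow> real \<Rightarrow> real \<Rightarrow> real" where
  "W_free \<gamma> \<delta> lam Y = \<delta> / lam - 1 / (2 * \<gamma> * lam * Y)"

definition A_const :: "real \<Rightarrow> real \<Rightarrow> real \<Rightarrow> real \<Rightarrow> real \<Rightarrow> real" where
  "A_const \<gamma> \<delta> lam m c = 2 * \<gamma> / m * (c - \<delta> / lam)"

definition B_const :: "real \<Rightarrow> real \<Rightarrow> real" where
  "B_const lam m = 1 / (lam * m)"

end

theory Submission
  imports Defs
begin

text \<open>In terms of \<open>u = Y + b / (3 a) X\<close> the equation \<^const>\<open>ode\<close> becomes \<open>X u'' = u' + a u'\<^sup>3\<close>,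
  that is \<^const>\<open>ode_tilde\<close>, and \<^const>\<open>sol\<close> becomes \<^const>\<open>sol_tilde\<close> with constants
  \<^const>\<open>J2\<close> and \<^const>\<open>J1\<close>. A nonconstant solution of \<^const>\<open>ode_tilde\<close> has the first
  integral \<open>X / Y' + a Y\<close> on each side of \<open>0\<close>; twice differentiability at \<open>0\<close> forces the two
  values to agree, and a further integration gives the conic.\<close>

section \<open>Bookkeeping for derivatives and solutions\<close>

lemma twice_differentiable_onI:
  assumes "open I"
    and Y1: "\<And>x. x \<in> I \<Longrightarrow> (Y has_real_derivative Y1 x) (at x)"
    and Y2: "\<And>x. x \<in> I \<Longrightarrow> (Y1 has_real_derivative Y2 x) (at x)"
  shows "twice_differentiable_on Y I"
    and "x \<in> I \<Longrightarrow> deriv Y x = Y1 x"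
    and "x \<in> I \<Longrightarrow> deriv (deriv Y) x = Y2 x"
proof -
  have 1: "deriv Y x = Y1 x" if "x \<in> I" for x
    using Y1[OF that] by (rule DERIV_imp_deriv)
  have 2: "(deriv Y has_real_derivative Y2 x) (at x)" if "x \<in> I" for x
    using has_field_derivative_transform_within_open[OF Y2[OF that] \<open>open I\<close> that] 1 by simp
  show "twice_differentiable_on Y I"
    unfolding twice_differentiable_on_def
    using Y1 2 real_differentiable_def by blast
  show "x \<in> I \<Longrightarrow> deriv Y x = Y1 x" by (rule 1)
  show "x \<in> I \<Longrightarrow> deriv (deriv Y) x = Y2 x" using 2 by (simp add: DERIV_imp_deriv)
qed

lemma twice_differentiable_onD:
  assumes "twice_differentiable_on Y I" "x \<in> I"
  shows "(Y has_real_derivative deriv Y x) (at x)"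
    and "(deriv Y has_real_derivative deriv (deriv Y) x) (at x)"
  using assms by (auto simp: twice_differentiable_on_def DERIV_deriv_iff_real_differentiable)

lemma solves_ode2I:
  assumes "open_interval I"
    and "\<And>x. x \<in> I \<Longrightarrow> (Y has_real_derivative Y1 x) (at x)"
    and "\<And>x. x \<in> I \<Longrightarrow> (Y1 has_real_derivative Y2 x) (at x)"
    and "\<And>x. x \<in> I \<Longrightarrow> F x (Y x) (Y1 x) (Y2 x)"
  shows "solves_ode2 F I Y"
proof -
  have "open I" using assms(1) by (simp add: open_interval_def)
  from twice_differentiable_onI[OF this assms(2,3)] assms(1,4) show ?thesis
    by (auto simp: solves_ode2_def)
qed

lemma solves_ode2D:
  assumes "solves_ode2 F I Y"
  shows "open_interval I" "open I" "is_interval I"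
    and "x \<in> I \<Longrightarrow> (Y has_real_derivative deriv Y x) (at x)"
    and "x \<in> I \<Longrightarrow> (deriv Y has_real_derivative deriv (deriv Y) x) (at x)"
    and "x \<in> I \<Longrightarrow> F x (Y x) (deriv Y x) (deriv (deriv Y) x)"
  using assms twice_differentiable_onD by (auto simp: solves_ode2_def open_interval_def)

section \<open>Calculus tools: linear equations, constancy, limits of zeros\<close>

text \<open>Integrating factor: with \<open>G\<close> an antiderivative of \<open>c\<close> on the
  segment between \<open>x0\<close> and \<open>x\<close>, the product \<open>h * exp (- G)\<close>
  has zero derivative there, and it vanishes at \<open>x0\<close>.\<close>

lemma linear_ode_zero:
  fixes h c :: "real \<Rightarrow> real"
  assumes "is_interval I" "continuous_on I c"
    and der: "\<And>x. x \<in> I \<Longrightarrow> (h has_real_derivative c x * h x) (at x)"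
    and "x0 \<in> I" "h x0 = 0" "x \<in> I"
  shows "h x = 0"
proof -
  define u v where "u = min x0 x" and "v = max x0 x"
  have sub: "{u..v} \<subseteq> I"
  proof -
    have "u \<in> I" "v \<in> I" using assms(4,6) by (simp_all add: u_def v_def min_def max_def)
    then show ?thesis by (intro subsetI) (rule mem_is_interval_1_I[OF assms(1), of u v], auto)
  qed
  have mem: "x0 \<in> {u..v}" "x \<in> {u..v}" by (auto simp: u_def v_def)
  define G where "G t = integral {u..t} c" for t
  have "((\<lambda>t. h t * exp (- G t)) has_field_derivative 0) (at t within {u..v})"
    if t: "t \<in> {u..v}" for t
  proof -
    have G: "(G has_real_derivative c t) (at t within {u..v})"
      unfolding G_def using integral_has_real_derivative[OF continuous_on_subset[OF assms(2) sub] t] .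
    have h: "(h has_real_derivative c t * h t) (at t within {u..v})"
      using der[of t] t sub by (blast intro: has_field_derivative_at_within)
    have "((\<lambda>t. exp (- G t)) has_real_derivative exp (- G t) * - c t) (at t within {u..v})"
      by (rule derivative_eq_intros G refl)+
    from DERIV_mult[OF h this] show ?thesis by (simp add: algebra_simps)
  qed
  then obtain k where "\<forall>t\<in>{u..v}. h t * exp (- G t) = k"
    using has_field_derivative_zero_constant[OF convex_closed_interval] by blast
  then have "h x * exp (- G x) = h x0 * exp (- G x0)" using mem by simp
  then show ?thesis using \<open>h x0 = 0\<close> by simp
qed

lemma DERIV_zero_on_constant:
  fixes f :: "real \<Rightarrow> real"
  assumes "is_interval I" "\<And>x. x \<in> I \<Longrightarrow> (f has_real_derivative 0) (at x)"
  shows "\<exists>k. \<forall>x\<in>I. f x = k"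
proof -
  have "convex I" using assms(1) by (simp add: is_interval_convex_1)
  then show ?thesis
    using has_field_derivative_zero_constant[of I f] assms(2)
    by (blast intro: has_field_derivative_at_within)
qed

text \<open>The value and the derivative at \<open>z\<close> are limits along \<open>S\<close>,
  where the function and then its difference quotient are zero. This extracts information at
  \<open>X = 0\<close>, where the equation degenerates.\<close>

lemma DERIV_zero_at_limit_of_zeros:
  fixes f :: "real \<Rightarrow> real"
  assumes der: "(f has_real_derivative D) (at z)" and lim: "z islimpt S"
    and zero: "\<And>x. x \<in> S \<Longrightarrow> f x = 0"
  shows "f z = 0" "D = 0"
proof -
  have nb: "at z within S \<noteq> bot" using lim by (simp add: trivial_limit_within)
  have ev: "eventually (\<lambda>x. f x = 0) (at z within S)"
    using zero by (simp add: eventually_at_filter)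
  have "(f \<longlongrightarrow> f z) (at z within S)"
    using DERIV_isCont[OF der] continuous_at_imp_continuous_at_within continuous_within by blast
  moreover have "(f \<longlongrightarrow> 0) (at z within S)"
    using ev by (rule tendsto_eventually)
  ultimately show fz: "f z = 0" using tendsto_unique[OF nb] by blast
  have "((\<lambda>x. (f x - f z) / (x - z)) \<longlongrightarrow> D) (at z within S)"
    using has_field_derivative_at_within[OF der] by (simp add: has_field_derivative_iff)
  moreover have "((\<lambda>x. (f x - f z) / (x - z)) \<longlongrightarrow> 0) (at z within S)"
    by (rule tendsto_eventually) (use ev fz in \<open>auto elim!: eventually_mono\<close>)
  ultimately show "D = 0" using tendsto_unique[OF nb] by blast
qed

lemma islimpt_half_line_Int:
  fixes \<sigma> :: real
  assumes "open I" "0 \<in> I" "\<sigma> \<noteq> 0"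
  shows "0 islimpt (I \<inter> {x. 0 < \<sigma> * x})"
proof -
  obtain e where e: "e > 0" "ball 0 e \<subseteq> I" using assms(1,2) open_contains_ball by blast
  show ?thesis unfolding islimpt_approachable
  proof (intro allI impI)
    fix d :: real assume "d > 0"
    define x where "x = sgn \<sigma> * (min d e / 2)"
    have "\<bar>x\<bar> = min d e / 2" "0 < \<sigma> * x"
      using \<open>d > 0\<close> e(1) assms(3) by (auto simp: x_def abs_mult sgn_if mult_less_0_iff)
    then show "\<exists>x'\<in>I \<inter> {x. 0 < \<sigma> * x}. x' \<noteq> 0 \<and> dist x' 0 < d"
      using e \<open>d > 0\<close> assms(3) by (intro bexI[of _ x]) (auto simp: subset_iff)
  qed
qed

section \<open>First integral and integrated conic for \<open>ode_tilde\<close>\<close>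

text \<open>The differentiated relation \<open>h = Y' (2 a Y + A) + 2 X = 0\<close> is a linear matter: along any
  solution, \<open>X h' = (1 + a Y'\<^sup>2) h\<close>.\<close>

lemma first_integral_half_line:
  assumes sol: "solves_ode2 (ode_tilde a) I Y"
    and S: "is_interval S" "S \<subseteq> I" "0 \<notin> S" and x0: "x0 \<in> S" "deriv Y x0 \<noteq> 0"
  shows "\<exists>A. \<forall>x\<in>S. deriv Y x * (2 * a * Y x + A) + 2 * x = 0"
proof -
  note D = solves_ode2D[OF sol]
  \<comment> \<open>The value that makes \<open>?h\<close> vanish at \<open>x0\<close>.\<close>
  define A where "A = - 2 * (x0 / deriv Y x0 + a * Y x0)"
  let ?h = "\<lambda>x. deriv Y x * (2 * a * Y x + A) + 2 * x"
  let ?c = "\<lambda>x. (1 + a * (deriv Y x)\<^sup>2) / x"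
  have "continuous_on S (deriv Y)"
    using D(5) S(2) by (meson DERIV_isCont continuous_at_imp_continuous_on subsetD)
  then have c: "continuous_on S ?c"
    using S(3) by (auto intro!: continuous_intros)
  have der: "(?h has_real_derivative ?c x * ?h x) (at x)" if "x \<in> S" for x
  proof -
    have x: "x \<in> I" "x \<noteq> 0" using that S by auto
    have "x * deriv (deriv Y) x = deriv Y x + a * deriv Y x ^ 3"
      using D(6)[OF x(1)] by (simp add: ode_tilde_def)
    then have e: "deriv (deriv Y) x = (deriv Y x + a * deriv Y x ^ 3) / x"
      using x by (simp add: field_simps)
    have "deriv (deriv Y) x * (2 * a * Y x + A) + deriv Y x * (2 * a * deriv Y x) + 2 = ?c x * ?h x"
      unfolding e using x by (simp add: field_simps power2_eq_square power3_eq_cube)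
    then show ?thesis
      by (auto intro!: derivative_eq_intros D(4) D(5) x(1) simp: algebra_simps)
  qed
  have "?h x0 = 0" using x0(2) by (simp add: A_def field_simps)
  then have "\<forall>x\<in>S. ?h x = 0" using linear_ode_zero[OF S(1) c der x0(1)] by blast
  then show ?thesis by blast
qed

text \<open>The linear equation for \<open>h\<close> is singular at 0, so each side of 0 first gets
  its own constant. The relation and its derivative, both evaluated at 0, force the two constants to
  coincide.\<close>

lemma first_integral:
  assumes sol: "solves_ode2 (ode_tilde a) I Y"
    and x1: "x1 \<in> I" "x1 \<noteq> 0" "deriv Y x1 \<noteq> 0"
  shows "\<exists>A. \<forall>x\<in>I. deriv Y x * (2 * a * Y x + A) + 2 * x = 0"
proof -
  note D = solves_ode2D[OF sol]
  \<comment> \<open>The part of \<open>I\<close> on the same side of 0 as \<open>s\<close>; only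
    \<open>s = x1\<close> and \<open>s = - x1\<close> matter below.\<close>
  define R where "R s = I \<inter> {x. 0 < s * x}" for s :: real
  have iR: "is_interval (R s)" for s
  proof -
    have "convex {x. 0 < s * x}" using convex_halfspace_gt[of 0 s] by simp
    then show ?thesis
      using D(3) by (simp add: R_def is_interval_convex_1 convex_Int)
  qed
  have side: "\<exists>A. \<forall>x\<in>R s. deriv Y x * (2 * a * Y x + A) + 2 * x = 0"
    if "x \<in> R s" "deriv Y x \<noteq> 0" for s x
    by (rule first_integral_half_line[OF sol iR _ _ that]) (auto simp: R_def)
  obtain A where A: "\<And>x. x \<in> R x1 \<Longrightarrow> deriv Y x * (2 * a * Y x + A) + 2 * x = 0"
    using side[of x1 x1] x1 by (auto simp: R_def zero_less_mult_iff)
  have split: "x \<in> R x1 \<or> x \<in> R (- x1) \<or> x = 0" if "x \<in> I" for x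
    using that x1(2) by (auto simp: R_def zero_less_mult_iff mult_less_0_iff)
  show ?thesis
  proof (cases "0 \<in> I")
    case False
    have "R (- x1) = {}"
    proof (rule ccontr)
      assume "R (- x1) \<noteq> {}"
      then obtain y where "y \<in> I" "x1 * y < 0" by (auto simp: R_def)
      then have "y \<le> 0 \<and> 0 \<le> x1 \<or> x1 \<le> 0 \<and> 0 \<le> y" by (auto simp: mult_less_0_iff)
      with D(3) x1(1) \<open>y \<in> I\<close> False show False unfolding is_interval_1 by blast
    qed
    then show ?thesis using split A False by blast
  next
    case 0: True
    have lim: "0 islimpt R s" if "s \<noteq> 0" for s
      unfolding R_def by (rule islimpt_half_line_Int[OF D(2) 0 that])
    \<comment> \<open>The relation holds on one side of 0 only, yet its two-sided derivative exists
      at 0; hence value and derivative there are both zero.\<close>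
    have glue: "deriv Y 0 * (2 * a * Y 0 + A) = 0"
        "deriv (deriv Y) 0 * (2 * a * Y 0 + A) + 2 * a * (deriv Y 0)\<^sup>2 + 2 = 0"
      if s: "s \<noteq> 0" and A: "\<And>x. x \<in> R s \<Longrightarrow> deriv Y x * (2 * a * Y x + A) + 2 * x = 0" for s A
    proof -
      have d: "((\<lambda>x. deriv Y x * (2 * a * Y x + A) + 2 * x) has_real_derivative
          deriv (deriv Y) 0 * (2 * a * Y 0 + A) + 2 * a * (deriv Y 0)\<^sup>2 + 2) (at 0)"
        by (auto intro!: derivative_eq_intros D(4) D(5) 0 simp: algebra_simps power2_eq_square)
      show "deriv Y 0 * (2 * a * Y 0 + A) = 0"
        using DERIV_zero_at_limit_of_zeros(1)[OF d lim[OF s] A] by simp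
      show "deriv (deriv Y) 0 * (2 * a * Y 0 + A) + 2 * a * (deriv Y 0)\<^sup>2 + 2 = 0"
        using DERIV_zero_at_limit_of_zeros(2)[OF d lim[OF s] A] by simp
    qed
    have mx1: "- x1 \<noteq> 0" using x1 by simp
    note g = glue[OF x1(2) A]
    \<comment> \<open>Were \<open>Y'\<close> zero on the whole opposite side, \<open>Y'\<close> and
      \<open>Y''\<close> would vanish at 0, and the second equation in \<open>g\<close> would read
      \<open>2 = 0\<close>.\<close>
    have "\<exists>x\<in>R (- x1). deriv Y x \<noteq> 0"
    proof (rule ccontr)
      assume "\<not> ?thesis"
      then have z: "\<And>x. x \<in> R (- x1) \<Longrightarrow> deriv Y x = 0" by blast
      show False
        using DERIV_zero_at_limit_of_zeros[OF D(5)[OF 0] lim[OF mx1] z] g by simp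
    qed
    then obtain A' where A': "\<And>x. x \<in> R (- x1) \<Longrightarrow> deriv Y x * (2 * a * Y x + A') + 2 * x = 0"
      using side by blast
    note g' = glue[OF mx1 A']
    \<comment> \<open>Differences of the two pairs of equations at 0. The term 2 in \<open>g\<close>
      prevents \<open>Y'\<close> and \<open>Y''\<close> from both vanishing there, so
      \<open>A - A'\<close> must.\<close>
    have "deriv Y 0 * (A - A') = 0" "deriv (deriv Y) 0 * (A - A') = 0"
      using g g' by algebra+
    moreover have "deriv Y 0 \<noteq> 0 \<or> deriv (deriv Y) 0 \<noteq> 0" using g by auto
    ultimately have "A' = A" by auto
    then have "\<forall>x\<in>I. deriv Y x * (2 * a * Y x + A) + 2 * x = 0"
      using split A A' g(1) by fastforce
    then show ?thesis by blast
  qed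
qed

text \<open>With \<open>g = 2 a Y + A\<close>, differentiating the conic twice gives
  \<open>Y' g + 2 X = 0\<close> and \<open>Y'' g + 2 a Y'^2 + 2 = 0\<close>. Eliminating the
  constant terms yields the equation multiplied by \<open>g\<close>.\<close>

lemma sol_tilde_solves:
  assumes I: "open_interval I" and Y: "twice_differentiable_on Y I"
    and imp: "implicit_on (sol_tilde a A B) I Y"
  shows "solves_ode2 (ode_tilde a) I Y"
proof -
  have "open I" using I by (simp add: open_interval_def)
  note D = twice_differentiable_onD[OF Y]
  have 1: "deriv Y x * (2 * a * Y x + A) + 2 * x = 0" if x: "x \<in> I" for x
  proof -
    have "((\<lambda>x. a * (Y x)\<^sup>2 + A * Y x + x\<^sup>2 + B) has_real_derivative
        deriv Y x * (2 * a * Y x + A) + 2 * x) (at x)"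
      by (auto intro!: derivative_eq_intros D(1) x simp: algebra_simps)
    from has_field_derivative_transform_within_open[OF this \<open>open I\<close> x, of "\<lambda>_. 0"]
    have "((\<lambda>_. 0) has_real_derivative deriv Y x * (2 * a * Y x + A) + 2 * x) (at x)"
      using imp by (auto simp: implicit_on_def sol_tilde_def)
    then show ?thesis using DERIV_unique[OF _ DERIV_const] by blast
  qed
  have "x * deriv (deriv Y) x = deriv Y x + a * deriv Y x ^ 3" if x: "x \<in> I" for x
  proof -
    have "((\<lambda>x. deriv Y x * (2 * a * Y x + A) + 2 * x) has_real_derivative
        deriv (deriv Y) x * (2 * a * Y x + A) + 2 * a * (deriv Y x)\<^sup>2 + 2) (at x)"
      by (auto intro!: derivative_eq_intros D x simp: algebra_simps power2_eq_square)
    from has_field_derivative_transform_within_open[OF this \<open>open I\<close> x, of "\<lambda>_. 0"] 1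
    have "((\<lambda>_. 0) has_real_derivative
        deriv (deriv Y) x * (2 * a * Y x + A) + 2 * a * (deriv Y x)\<^sup>2 + 2) (at x)" by auto
    then have 2: "deriv (deriv Y) x * (2 * a * Y x + A) + 2 * a * (deriv Y x)\<^sup>2 + 2 = 0"
      using DERIV_unique[OF _ DERIV_const] by blast
    show ?thesis
    proof (cases "2 * a * Y x + A = 0")
      case True
      \<comment> \<open>Here the factor cannot be cancelled, but both sides of the equation are
        zero. This occurs only for \<open>a < 0\<close>, where a degenerate conic is a pair of lines
        crossing on the axis \<open>X = 0\<close>.\<close>
      then have "x = 0" "1 + a * (deriv Y x)\<^sup>2 = 0" using 1[OF x] 2 by auto
      then show ?thesis by algebra
    next
      case False
      have "(2 * a * Y x + A) * (x * deriv (deriv Y) x) =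
          (2 * a * Y x + A) * (deriv Y x + a * deriv Y x ^ 3)"
        using 1[OF x] 2 by algebra
      then show ?thesis using False by simp
    qed
  qed
  then show ?thesis using I Y by (simp add: solves_ode2_def ode_tilde_def)
qed

text \<open>The first integral is the derivative of the conic, so one more integration gives
  existence. Constants are the exceptional solutions: on an interval they lie on no such conic,
  because \<open>X^2\<close> varies.\<close>

lemma ode_tilde_solution_unique:
  assumes sol: "solves_ode2 (ode_tilde a) I Y"
    and nc: "\<not> (\<exists>k. \<forall>x\<in>I. Y x = k)"
  shows "\<exists>!p. case p of (A, B) \<Rightarrow> implicit_on (sol_tilde a A B) I Y"
proof -
  note D = solves_ode2D[OF sol]
  \<comment> \<open>\<open>first_integral\<close> starts from a point off 0. If \<open>Y'\<close>
    vanished at all of these, it would vanish at 0 as well by continuity, making \<open>Y\<close>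
    constant.\<close>
  have "\<exists>x\<in>I. x \<noteq> 0 \<and> deriv Y x \<noteq> 0"
  proof (rule ccontr)
    assume "\<not> ?thesis"
    then have z: "\<And>x. x \<in> I \<Longrightarrow> x \<noteq> 0 \<Longrightarrow> deriv Y x = 0" by blast
    have "deriv Y 0 = 0" if "0 \<in> I"
      using DERIV_zero_at_limit_of_zeros(1)[OF D(5)[OF that]
          islimpt_half_line_Int[OF D(2) that, of 1]] z by simp
    then have "\<And>x. x \<in> I \<Longrightarrow> (Y has_real_derivative 0) (at x)" using z D(4) by metis
    then show False using DERIV_zero_on_constant[OF D(3)] nc by blast
  qed
  then obtain A where A: "\<And>x. x \<in> I \<Longrightarrow> deriv Y x * (2 * a * Y x + A) + 2 * x = 0"
    using first_integral[OF sol] by blast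
  have "((\<lambda>x. a * (Y x)\<^sup>2 + A * Y x + x\<^sup>2) has_real_derivative 0) (at x)" if "x \<in> I" for x
    using A[OF that]
    by (auto intro!: derivative_eq_intros D(4) that simp: algebra_simps)
  from DERIV_zero_on_constant[OF D(3) this]
  obtain k where "\<And>x. x \<in> I \<Longrightarrow> a * (Y x)\<^sup>2 + A * Y x + x\<^sup>2 = k" by blast
  then have ex: "implicit_on (sol_tilde a A (- k)) I Y"
    by (simp add: implicit_on_def sol_tilde_def)
  obtain i where i: "i \<in> I" using D(1) by (auto simp: open_interval_def)
  have uniq: "A' = A \<and> B' = - k" if "implicit_on (sol_tilde a A' B') I Y" for A' B'
  proof -
    \<comment> \<open>Subtracting two conics cancels the quadratic terms; a nonzero
      \<open>A' - A\<close> would then make \<open>Y\<close> constant.\<close>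
    have e: "(A' - A) * Y x = - k - B'" if "x \<in> I" for x
      using \<open>implicit_on (sol_tilde a A' B') I Y\<close> ex that
      by (auto simp: implicit_on_def sol_tilde_def algebra_simps dest!: bspec[OF _ that])
    have "A' = A"
    proof (rule ccontr)
      assume "A' \<noteq> A"
      then have "\<forall>x\<in>I. Y x = (- k - B') / (A' - A)" using e by (simp add: field_simps)
      then show False using nc by blast
    qed
    then show ?thesis using e[OF i] by simp
  qed
  show ?thesis
  proof (rule ex1I[of _ "(A, - k)"])
    show "case (A, - k) of (A, B) \<Rightarrow> implicit_on (sol_tilde a A B) I Y" using ex by simp
    show "p = (A, - k)" if "case p of (A, B) \<Rightarrow> implicit_on (sol_tilde a A B) I Y" for p
      using uniq[of "fst p" "snd p"] that by (simp add: case_prod_unfold prod_eq_iff)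
  qed
qed

section \<open>Initial data and the general solution of \<open>ode_tilde\<close>\<close>

text \<open>The slope determines \<open>A\<close>, the point determines \<open>B\<close>, and the
  quadratic formula gives an explicit branch of the conic near \<open>x0\<close>.\<close>

lemma sol_tilde_fits_initial_data:
  assumes a: "a \<noteq> 0" and x0: "x0 \<noteq> 0" and p0: "p0 \<noteq> 0"
  shows "\<exists>A B I Y. open_interval I \<and> x0 \<in> I \<and> twice_differentiable_on Y I \<and>
      implicit_on (sol_tilde a A B) I Y \<and> Y x0 = y0 \<and> deriv Y x0 = p0"
proof -
  \<comment> \<open>Solves \<open>p0 * (2 * a * y0 + A) + 2 * x0 = 0\<close>, the differentiated
    conic at the initial point.\<close>
  define A where "A = - 2 * (x0 / p0 + a * y0)"
  define B where "B = - (a * y0\<^sup>2 + A * y0 + x0\<^sup>2)"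
  \<comment> \<open>Selects the root of the quadratic in \<open>Y\<close> that passes through
    \<open>y0\<close>.\<close>
  define \<sigma> where "\<sigma> = sgn (2 * a * y0 + A)"
  have g0: "2 * a * y0 + A = - 2 * x0 / p0" using p0 by (simp add: A_def field_simps)
  then have "2 * a * y0 + A \<noteq> 0" using x0 p0 by simp
  then have \<sigma>: "\<sigma>\<^sup>2 = 1" "\<sigma> \<noteq> 0" "\<sigma> * \<bar>2 * a * y0 + A\<bar> = 2 * a * y0 + A"
    by (auto simp: \<sigma>_def sgn_if)
  \<comment> \<open>The discriminant of the conic as a quadratic in \<open>Y\<close>. It is positive
    at \<open>x0\<close> because \<open>x0\<close> is nonzero, hence on a ball around it, where the
    square root is smooth.\<close>
  define \<Delta> where "\<Delta> x = A\<^sup>2 - 4 * a * B - 4 * a * x\<^sup>2" for x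
  have \<Delta>0: "\<Delta> x0 = (2 * a * y0 + A)\<^sup>2"
    by (simp add: \<Delta>_def B_def power2_eq_square algebra_simps)
  have cont: "continuous_on UNIV \<Delta>" unfolding \<Delta>_def by (intro continuous_intros)
  have "open {x. 0 < \<Delta> x}" by (rule open_Collect_less[OF continuous_on_const cont])
  moreover have "x0 \<in> {x. 0 < \<Delta> x}" using \<open>2 * a * y0 + A \<noteq> 0\<close> by (simp add: \<Delta>0)
  ultimately obtain e where e: "e > 0" "ball x0 e \<subseteq> {x. 0 < \<Delta> x}"
    using open_contains_ball by blast
  define I where "I = ball x0 e"
  have I: "open_interval I" "open I" "x0 \<in> I"
    using e(1) by (auto simp: I_def open_interval_def is_interval_convex_1)
  have pos: "\<Delta> x > 0" if "x \<in> I" for x using e(2) that by (auto simp: I_def)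
  define Y where "Y x = (\<sigma> * sqrt (\<Delta> x) - A) / (2 * a)" for x
  define Y1 where "Y1 x = - 2 * \<sigma> * x / sqrt (\<Delta> x)" for x
  define Y2 where "Y2 x = - 2 * \<sigma> / sqrt (\<Delta> x) - 8 * \<sigma> * a * x\<^sup>2 / sqrt (\<Delta> x) ^ 3" for x
  have s: "((\<lambda>x. sqrt (\<Delta> x)) has_real_derivative - 4 * a * x / sqrt (\<Delta> x)) (at x)"
    if "x \<in> I" for x
    using pos[OF that] unfolding \<Delta>_def
    by (auto intro!: derivative_eq_intros simp: field_simps)
  have Y1: "(Y has_real_derivative Y1 x) (at x)" if "x \<in> I" for x
    unfolding Y_def Y1_def
    by (rule derivative_eq_intros s that refl)+ (use a in \<open>simp_all add: field_simps\<close>)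
  have Y2: "(Y1 has_real_derivative Y2 x) (at x)" if "x \<in> I" for x
    unfolding Y1_def Y2_def
    by (rule derivative_eq_intros s that refl)+
      (use pos[OF that] in \<open>auto simp: field_simps power2_eq_square power3_eq_cube\<close>)
  note T = twice_differentiable_onI[OF I(2) Y1 Y2]
  have "sol_tilde a A B x (Y x) = 0" if "x \<in> I" for x
  proof -
    have "2 * a * Y x + A = \<sigma> * sqrt (\<Delta> x)" using a by (simp add: Y_def)
    then have "(2 * a * Y x + A)\<^sup>2 = \<Delta> x"
      using pos[OF that] \<sigma>(1) by (simp add: power_mult_distrib)
    then have "4 * a * (a * (Y x)\<^sup>2 + A * Y x + x\<^sup>2 + B) = 0"
      unfolding \<Delta>_def by algebra
    then show ?thesis using a by (simp add: sol_tilde_def)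
  qed
  moreover have "Y x0 = y0"
    using a \<sigma>(3) by (simp add: Y_def \<Delta>0)
  moreover have "deriv Y x0 = p0"
  proof -
    have "deriv Y x0 = - 2 * \<sigma> * x0 / \<bar>2 * a * y0 + A\<bar>"
      using T(2)[of x0] I(3) by (simp add: Y1_def \<Delta>0)
    \<comment> \<open>Numerator and denominator are multiplied by \<sigma>, which removes the
      absolute value.\<close>
    also have "\<dots> = - 2 * \<sigma>\<^sup>2 * x0 / (2 * a * y0 + A)"
      by (subst \<sigma>(3)[symmetric]) (use \<sigma>(2) in \<open>simp add: power2_eq_square\<close>)
    also have "\<dots> = p0" unfolding g0 \<sigma>(1) using x0 p0 by simp
    finally show ?thesis .
  qed
  ultimately show ?thesis using I T(1) unfolding implicit_on_def by blast
qed

lemma general_solution_ode_tilde: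
  assumes "a \<noteq> 0"
  shows "general_solution (ode_tilde a) (sol_tilde a)
      {\<lambda>X. k |k. True} {(X, Y, p). X \<noteq> 0 \<and> p \<noteq> 0}"
  unfolding general_solution_def
proof (intro conjI allI impI)
  fix I Y A B
  assume "open_interval I" "twice_differentiable_on Y I" "implicit_on (sol_tilde a A B) I Y"
  then show "solves_ode2 (ode_tilde a) I Y" by (rule sol_tilde_solves)
next
  fix I Y
  assume "solves_ode2 (ode_tilde a) I Y" "\<not> (\<exists>g\<in>{\<lambda>X. k |k. True}. \<forall>x\<in>I. Y x = g x)"
  then show "\<exists>!p. case p of (A, B) \<Rightarrow> implicit_on (sol_tilde a A B) I Y"
    by (intro ode_tilde_solution_unique) auto
next
  show "\<forall>(x0, y0, p0)\<in>{(X, Y, p). X \<noteq> 0 \<and> p \<noteq> 0}.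
      \<exists>A B I Y. open_interval I \<and> x0 \<in> I \<and> twice_differentiable_on Y I \<and>
        implicit_on (sol_tilde a A B) I Y \<and> Y x0 = y0 \<and> deriv Y x0 = p0"
    using sol_tilde_fits_initial_data[OF assms] by auto
qed

section \<open>The shear between \<open>ode\<close> and \<open>ode_tilde\<close>\<close>

lemma twice_differentiable_on_add_linear:
  assumes "open I" "twice_differentiable_on Y I"
  shows "twice_differentiable_on (\<lambda>x. Y x + s * x) I"
    and "x \<in> I \<Longrightarrow> deriv (\<lambda>x. Y x + s * x) x = deriv Y x + s"
    and "x \<in> I \<Longrightarrow> deriv (deriv (\<lambda>x. Y x + s * x)) x = deriv (deriv Y) x"
proof -
  note D = twice_differentiable_onD[OF assms(2)]
  have 1: "((\<lambda>x. Y x + s * x) has_real_derivative deriv Y x + s) (at x)" if "x \<in> I" for x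
    by (auto intro!: derivative_eq_intros D that)
  have 2: "((\<lambda>x. deriv Y x + s) has_real_derivative deriv (deriv Y) x) (at x)" if "x \<in> I" for x
    by (auto intro!: derivative_eq_intros D that)
  note T = twice_differentiable_onI[OF assms(1) 1 2]
  show "twice_differentiable_on (\<lambda>x. Y x + s * x) I"
    and "x \<in> I \<Longrightarrow> deriv (\<lambda>x. Y x + s * x) x = deriv Y x + s"
    and "x \<in> I \<Longrightarrow> deriv (deriv (\<lambda>x. Y x + s * x)) x = deriv (deriv Y) x"
    using T by auto
qed

lemma twice_differentiable_on_add_linear_iff:
  assumes "open I"
  shows "twice_differentiable_on (\<lambda>x. Y x + s * x) I \<longleftrightarrow> twice_differentiable_on Y I"
proof
  assume "twice_differentiable_on (\<lambda>x. Y x + s * x) I"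
  from twice_differentiable_on_add_linear(1)[OF assms this, of "- s"]
  show "twice_differentiable_on Y I" by simp
qed (rule twice_differentiable_on_add_linear(1)[OF assms])

text \<open>The right-hand side of \<open>ode\<close> is the expansion of \<open>p + a p^3\<close>
  at \<open>p = Y' + b / (3 a)\<close>; adding a linear term to \<open>Y\<close> leaves
  \<open>Y''\<close> unchanged.\<close>

lemma ode_shear:
  assumes "a \<noteq> 0"
  shows "ode a b X Y Y1 Y2 \<longleftrightarrow> ode_tilde a X (Y + b / (3 * a) * X) (Y1 + b / (3 * a)) Y2"
proof -
  have "b / (3 * a) + b ^ 3 / (27 * a ^ 2) + (1 + b ^ 2 / (3 * a)) * Y1 + b * Y1 ^ 2 + a * Y1 ^ 3
      = (Y1 + b / (3 * a)) + a * (Y1 + b / (3 * a)) ^ 3"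
    using assms by (simp add: field_simps power2_eq_square power3_eq_cube)
  then show ?thesis unfolding ode_def ode_tilde_def by argo
qed

lemma solves_ode_shear:
  assumes "a \<noteq> 0"
  shows "solves_ode2 (ode a b) I Y \<longleftrightarrow> solves_ode2 (ode_tilde a) I (\<lambda>x. Y x + b / (3 * a) * x)"
proof (cases "open_interval I \<and> twice_differentiable_on Y I")
  case True
  then have "open I" by (simp add: open_interval_def)
  then show ?thesis
    using True twice_differentiable_on_add_linear[where I = I and Y = Y and s = "b / (3 * a)"]
    by (simp add: solves_ode2_def ode_shear[OF assms] del: times_divide_eq_left)
next
  case False
  then show ?thesis
    using twice_differentiable_on_add_linear_iff[of I Y "b / (3 * a)"]
    by (auto simp: solves_ode2_def open_interval_def)
qed

text \<open>Completing the square: the quadratic part of \<open>sol\<close> is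
  \<open>a (Y + b / (3 a) X)^2 + X^2\<close>.\<close>

lemma sol_shear:
  assumes "a \<noteq> 0"
  shows "sol a b A B X Y = sol_tilde a (J2 b A) (J1 b B) X (Y + b / (3 * a) * X)"
  using assms by (simp add: sol_def sol_tilde_def field_simps power2_eq_square)

lemma implicit_on_shear:
  assumes "a \<noteq> 0"
  shows "implicit_on (sol a b A B) I Y \<longleftrightarrow>
    implicit_on (sol_tilde a (J2 b A) (J1 b B)) I (\<lambda>x. Y x + b / (3 * a) * x)"
  by (simp add: implicit_on_def sol_shear[OF assms])

text \<open>For fixed \<open>b\<close> the constants of the two conics correspond one to one. Unique
  fitting and surjectivity onto initial data therefore pass from \<open>sol_tilde\<close> to
  \<open>sol\<close>.\<close>

lemma bij_J: "bij (\<lambda>(A, B). (J2 b A, J1 b B))"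
proof (rule o_bij)
  let ?g = "\<lambda>(A, B). (A / exp (b / 2), (B - 1) / exp b + 1)"
  show "?g \<circ> (\<lambda>(A, B). (J2 b A, J1 b B)) = id" "(\<lambda>(A, B). (J2 b A, J1 b B)) \<circ> ?g = id"
    by (auto simp: fun_eq_iff J1_def J2_def)
qed

lemma bij_ex1_comp:
  assumes "bij f" "\<exists>!q. P q"
  shows "\<exists>!p. P (f p)"
  using assms by (metis bij_pointE)

text \<open>Everything is transported along the shear, which works on every interval, including
  across 0, unlike \<open>X_tilde\<close>. The exceptional lines and the excluded slope correspond
  to constant \<open>u\<close> and \<open>u' = 0\<close>.\<close>

lemma general_solution_ode:
  assumes a: "a \<noteq> 0"
  shows "general_solution (ode a b) (sol a b)
      {\<lambda>X. k - b / (3 * a) * X |k. True} {(X, Y, p). X \<noteq> 0 \<and> p \<noteq> - b / (3 * a)}"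
  unfolding general_solution_def
proof (intro conjI allI impI)
  fix I Y A B
  assume I: "open_interval I" "twice_differentiable_on Y I" "implicit_on (sol a b A B) I Y"
  then have "open I" by (simp add: open_interval_def)
  from sol_tilde_solves[OF I(1) twice_differentiable_on_add_linear(1)[OF this I(2)]]
  show "solves_ode2 (ode a b) I Y"
    using I(3) unfolding solves_ode_shear[OF a] implicit_on_shear[OF a] by blast
next
  fix I Y
  let ?u = "\<lambda>x. Y x + b / (3 * a) * x"
  assume "solves_ode2 (ode a b) I Y"
    and nc: "\<not> (\<exists>g\<in>{\<lambda>X. k - b / (3 * a) * X |k. True}. \<forall>x\<in>I. Y x = g x)"
  then have sol: "solves_ode2 (ode_tilde a) I ?u" by (simp add: solves_ode_shear[OF a])
  have "\<not> (\<exists>k. \<forall>x\<in>I. ?u x = k)"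
  proof
    assume "\<exists>k. \<forall>x\<in>I. ?u x = k"
    then obtain k where "\<forall>x\<in>I. Y x = k - b / (3 * a) * x" by (auto simp: eq_diff_eq)
    then show False using nc by (auto dest: spec[of _ k])
  qed
  then have ex1: "\<exists>!p. case p of (A, B) \<Rightarrow> implicit_on (sol_tilde a A B) I ?u"
    by (rule ode_tilde_solution_unique[OF sol])
  show "\<exists>!p. case p of (A, B) \<Rightarrow> implicit_on (sol a b A B) I Y"
    using bij_ex1_comp[OF bij_J[of b] ex1]
    by (simp add: implicit_on_shear[OF a] case_prod_unfold)
next
  show "\<forall>(x0, y0, p0)\<in>{(X, Y, p). X \<noteq> 0 \<and> p \<noteq> - b / (3 * a)}.
      \<exists>A B I Y. open_interval I \<and> x0 \<in> I \<and> twice_differentiable_on Y I \<and>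
        implicit_on (sol a b A B) I Y \<and> Y x0 = y0 \<and> deriv Y x0 = p0"
  proof (intro ballI, clarify)
    fix x0 y0 p0 :: real
    let ?s = "b / (3 * a)"
    assume "x0 \<noteq> 0" and p0: "p0 \<noteq> - b / (3 * a)"
    have "p0 + ?s \<noteq> 0" using p0 minus_divide_left[of b "3 * a"] by linarith
    from sol_tilde_fits_initial_data[OF a \<open>x0 \<noteq> 0\<close> this, of "y0 + ?s * x0"]
    obtain A' B' I U where U: "open_interval I" "x0 \<in> I" "twice_differentiable_on U I"
      "implicit_on (sol_tilde a A' B') I U" "U x0 = y0 + ?s * x0" "deriv U x0 = p0 + ?s"
      by blast
    obtain A B where AB: "A' = J2 b A" "B' = J1 b B"
      using bij_is_surj[OF bij_J, of b] by (force simp: surj_def dest: spec[of _ "(A', B')"])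
    have "open I" using U(1) by (simp add: open_interval_def)
    define Y where "Y = (\<lambda>x. U x + (- ?s) * x)"
    note T = twice_differentiable_on_add_linear[OF \<open>open I\<close> U(3), where s = "- ?s", folded Y_def]
    have "(\<lambda>x. Y x + ?s * x) = U" by (simp add: Y_def fun_eq_iff)
    then have "implicit_on (sol a b A B) I Y"
      using U(4) by (simp add: implicit_on_shear[OF a] AB)
    moreover have "Y x0 = y0" "deriv Y x0 = p0"
      using U(5,6) T(2)[OF U(2)] by (simp_all add: Y_def)
    ultimately show "\<exists>A B I Y. open_interval I \<and> x0 \<in> I \<and> twice_differentiable_on Y I \<and>
        implicit_on (sol a b A B) I Y \<and> Y x0 = y0 \<and> deriv Y x0 = p0"
      using U(1,2) T(1) by blast
  qed
qed

section \<open>The point transformation\<close>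

text \<open>The transformation and its inverse are both of the following form, which is why one
  direction suffices.\<close>

lemma ode_tilde_point_transformation:
  fixes c k \<sigma> :: real
  assumes kc: "k\<^sup>2 * c = 1" and \<sigma>: "\<sigma>\<^sup>2 = 1"
    and I: "open_interval I" "\<And>x. x \<in> I \<Longrightarrow> c * (1 + x\<^sup>2) > 1"
    and sol: "solves_ode2 (ode_tilde a) J V"
    and J: "\<And>x. x \<in> I \<Longrightarrow> \<sigma> * sqrt (c * (1 + x\<^sup>2) - 1) \<in> J"
    and U: "\<And>x. x \<in> I \<Longrightarrow> U x = k * V (\<sigma> * sqrt (c * (1 + x\<^sup>2) - 1))"
  shows "solves_ode2 (ode_tilde a) I U"
proof -
  note D = solves_ode2D[OF sol]
  have "open I" using I(1) by (simp add: open_interval_def)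
  define \<phi> where "\<phi> x = \<sigma> * sqrt (c * (1 + x\<^sup>2) - 1)" for x
  have \<phi>J: "\<phi> x \<in> J" if "x \<in> I" for x using J[OF that] by (simp add: \<phi>_def)
  have \<phi>0: "\<phi> x \<noteq> 0" if "x \<in> I" for x using I(2)[OF that] \<sigma> by (auto simp: \<phi>_def)
  \<comment> \<open>Amounts to differentiating \<open>\<phi>^2 = c (1 + x^2) - 1\<close>; writing
    the result over \<open>\<phi>\<close> absorbs the sign \<sigma>.\<close>
  have d\<phi>: "(\<phi> has_real_derivative c * x / \<phi> x) (at x)" if "x \<in> I" for x
  proof -
    have "(\<phi> has_real_derivative \<sigma> * (c * x / sqrt (c * (1 + x\<^sup>2) - 1))) (at x)"
      unfolding \<phi>_def using I(2)[OF that]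
      by (auto intro!: derivative_eq_intros simp: field_simps)
    moreover have "\<sigma> * (c * x / sqrt (c * (1 + x\<^sup>2) - 1)) = c * x / \<phi> x"
      using \<phi>0[OF that] \<sigma> by (auto simp: \<phi>_def field_simps power2_eq_square)
    ultimately show ?thesis by simp
  qed
  define U1 where "U1 x = k * (deriv V (\<phi> x) * (c * x / \<phi> x))" for x
  define U2 where "U2 x = k * (deriv (deriv V) (\<phi> x) * (c * x / \<phi> x)\<^sup>2
      + deriv V (\<phi> x) * (c / \<phi> x - c * x * (c * x / \<phi> x) / (\<phi> x)\<^sup>2))" for x
  have V: "((\<lambda>x. V (\<phi> x)) has_real_derivative deriv V (\<phi> x) * (c * x / \<phi> x)) (at x)"
    and V': "((\<lambda>x. deriv V (\<phi> x)) has_real_derivative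
        deriv (deriv V) (\<phi> x) * (c * x / \<phi> x)) (at x)" if "x \<in> I" for x
    using DERIV_chain2[OF D(4)[OF \<phi>J] d\<phi>] DERIV_chain2[OF D(5)[OF \<phi>J] d\<phi>] that by auto
  have U1: "(U has_real_derivative U1 x) (at x)" if "x \<in> I" for x
  proof -
    have "((\<lambda>x. k * V (\<phi> x)) has_real_derivative U1 x) (at x)"
      unfolding U1_def by (rule DERIV_cmult[OF V[OF that]])
    then show ?thesis
      by (rule has_field_derivative_transform_within_open[OF _ \<open>open I\<close> that]) (simp add: U \<phi>_def)
  qed
  have U2: "(U1 has_real_derivative U2 x) (at x)" if "x \<in> I" for x
    unfolding U1_def U2_def using \<phi>0[OF that]
    by (auto intro!: derivative_eq_intros V' d\<phi> that simp: field_simps power2_eq_square)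
  have "x * U2 x = U1 x + a * U1 x ^ 3" if "x \<in> I" for x
  proof -
    have n: "\<phi> x \<noteq> 0" using \<phi>0[OF that] .
    have o: "\<phi> x * deriv (deriv V) (\<phi> x) = deriv V (\<phi> x) + a * deriv V (\<phi> x) ^ 3"
      using D(6)[OF \<phi>J[OF that]] by (simp add: ode_tilde_def)
    \<comment> \<open>Arranged so that the bracket is exactly what \<open>ode_tilde\<close> for
      \<open>V\<close> evaluates to \<open>a V'^3\<close>.\<close>
    have "x * U2 x = U1 x + k * c\<^sup>2 * (x / \<phi> x) ^ 3
        * (\<phi> x * deriv (deriv V) (\<phi> x) - deriv V (\<phi> x))"
      using n by (simp add: U1_def U2_def field_simps power2_eq_square power3_eq_cube)
    also have "\<dots> = U1 x + a * (k * c\<^sup>2) * (deriv V (\<phi> x) * (x / \<phi> x)) ^ 3"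
      unfolding o power_mult_distrib by simp
    \<comment> \<open>The scaling condition \<open>k^2 c = 1\<close> is what turns the remaining
      factor into the cube needed for \<open>a U1^3\<close>.\<close>
    also have "k * c\<^sup>2 = (k * c) ^ 3" using kc by algebra
    finally show ?thesis
      by (simp add: U1_def power_mult_distrib power_divide)
  qed
  then show ?thesis
    by (intro solves_ode2I[OF I(1) U1 U2]) (auto simp: ode_tilde_def)
qed

text \<open>Recovers the sign that the square root in the inverse of \<open>X_tilde\<close>
  loses.\<close>

lemma interval_sign:
  fixes I :: "real set"
  assumes "is_interval I" "0 \<notin> I"
  obtains \<sigma> :: real where "\<sigma>\<^sup>2 = 1" "\<And>x. x \<in> I \<Longrightarrow> \<sigma> * \<bar>x\<bar> = x"
proof (cases "\<exists>x\<in>I. x < 0")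
  case True
  then have "\<And>x. x \<in> I \<Longrightarrow> x < 0"
    using assms unfolding is_interval_1 by (meson less_imp_le not_less)
  then show ?thesis by (intro that[of "- 1"]) fastforce+
next
  case False
  then show ?thesis by (intro that[of 1]) fastforce+
qed

text \<open>After the shear both equations are \<open>ode_tilde\<close>, so the transformation is a
  symmetry of that equation. The forward direction takes \<open>k = exp (- b / 2)\<close> and
  \<open>c = exp b\<close>, the backward one the reciprocals.\<close>

lemma point_transformation_solves:
  assumes a: "a \<noteq> 0" and I: "open_interval I"
    and sub: "I \<subseteq> {X. X \<noteq> 0 \<and> exp (- b) * (1 + X ^ 2) > 1}"
    and Yt: "\<And>X. X \<in> I \<Longrightarrow> Yt (X_tilde b X) = Y_tilde a b X (Y X)"
  shows "solves_ode2 (ode a b) I Y \<longleftrightarrow> solves_ode2 (ode_tilde a) (X_tilde b ` I) Yt"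
proof -
  have Iop: "open I" "is_interval I" "I \<noteq> {}" "0 \<notin> I"
    using I sub by (auto simp: open_interval_def)
  obtain \<sigma> :: real where \<sigma>: "\<sigma>\<^sup>2 = 1" "\<And>x. x \<in> I \<Longrightarrow> \<sigma> * \<bar>x\<bar> = x"
    using interval_sign[OF Iop(2,4)] by blast
  have ee: "exp b * exp (- b) = 1" "exp (b / 2) * exp (- b / 2) = 1"
    "(exp (b / 2))\<^sup>2 = exp b" "(exp (- b / 2))\<^sup>2 = exp (- b)"
    by (simp_all flip: exp_add exp_double)
  have inv: "exp b * (1 + (X_tilde b x)\<^sup>2) = 1 + x\<^sup>2" if "x \<in> I" for x
  proof -
    have "(X_tilde b x)\<^sup>2 = exp (- b) * (1 + x\<^sup>2) - 1"
      using sub that by (auto simp: X_tilde_def)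
    then show ?thesis using ee(1) by (simp add: mult.assoc[symmetric])
  qed
  have left_inv: "\<sigma> * sqrt (exp b * (1 + (X_tilde b x)\<^sup>2) - 1) = x" if "x \<in> I" for x
    using inv[OF that] \<sigma>(2)[OF that] by simp
  have J: "open_interval (X_tilde b ` I)"
  proof -
    have c: "continuous_on I (X_tilde b)" unfolding X_tilde_def by (intro continuous_intros)
    moreover have "inj_on (X_tilde b) I" using left_inv by (metis inj_onI)
    ultimately have "open (X_tilde b ` I)" using invariance_of_domain Iop(1) by blast
    moreover have "is_interval (X_tilde b ` I)"
      using connected_continuous_image[OF c] Iop(2) by (simp add: is_interval_connected_1)
    ultimately show ?thesis using Iop(3) by (simp add: open_interval_def)
  qed
  let ?u = "\<lambda>x. Y x + b / (3 * a) * x"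
  show ?thesis unfolding solves_ode_shear[OF a]
  proof
    assume u: "solves_ode2 (ode_tilde a) I ?u"
    show "solves_ode2 (ode_tilde a) (X_tilde b ` I) Yt"
    proof (rule ode_tilde_point_transformation[OF _ \<sigma>(1) J _ u])
      show "(exp (- b / 2))\<^sup>2 * exp b = 1" using ee(1,4) by (simp add: mult.commute)
    next
      fix t assume "t \<in> X_tilde b ` I"
      then obtain x where x: "x \<in> I" "t = X_tilde b x" by blast
      then have "x \<noteq> 0" using Iop by auto
      \<comment> \<open>By \<open>inv\<close> this says \<open>1 < 1 + x^2\<close>, so it rests on
        \<open>I\<close> avoiding 0.\<close>
      show "1 < exp b * (1 + t\<^sup>2)" using \<open>x \<noteq> 0\<close> inv[OF x(1)] by (simp add: x(2))
      show "\<sigma> * sqrt (exp b * (1 + t\<^sup>2) - 1) \<in> I" using left_inv[OF x(1)] x by simp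
      show "Yt t = exp (- b / 2) * (Y (\<sigma> * sqrt (exp b * (1 + t\<^sup>2) - 1))
          + b / (3 * a) * (\<sigma> * sqrt (exp b * (1 + t\<^sup>2) - 1)))"
        using Yt[OF x(1)] unfolding x(2) left_inv[OF x(1)] Y_tilde_def .
    qed
  next
    assume V: "solves_ode2 (ode_tilde a) (X_tilde b ` I) Yt"
    show "solves_ode2 (ode_tilde a) I ?u"
    proof (rule ode_tilde_point_transformation[OF _ _ I _ V])
      show "(exp (b / 2))\<^sup>2 * exp (- b) = 1" using ee by simp
      show "(1::real)\<^sup>2 = 1" by simp
    next
      fix x assume x: "x \<in> I"
      show "1 < exp (- b) * (1 + x\<^sup>2)" using sub x by auto
      show "1 * sqrt (exp (- b) * (1 + x\<^sup>2) - 1) \<in> X_tilde b ` I"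
        using x by (simp add: X_tilde_def)
      show "?u x = exp (b / 2) * Yt (1 * sqrt (exp (- b) * (1 + x\<^sup>2) - 1))"
        using Yt[OF x] ee(2) by (simp add: X_tilde_def Y_tilde_def mult.assoc[symmetric])
    qed
  qed
qed

text \<open>With \<open>r = exp (- b / 2)\<close>, taking \<open>r^2\<close> out of the transformed
  conic leaves \<open>A / r\<close> and \<open>(B - 1) / r^2 + 1\<close> as coefficients; this is
  the origin of \<open>J2\<close> and \<open>J1\<close>.\<close>

lemma point_transformation_sol:
  assumes a: "a \<noteq> 0" and X: "exp (- b) * (1 + X ^ 2) > 1"
  shows "sol_tilde a A B (X_tilde b X) (Y_tilde a b X Y) = exp (- b) * sol a b A B X Y"
proof -
  define u where "u = Y + b / (3 * a) * X"
  define r where "r = exp (- b / 2)"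
  have r: "exp (- b) = r\<^sup>2" "exp (b / 2) = 1 / r" "exp b = 1 / r\<^sup>2" "r \<noteq> 0"
    by (simp_all add: r_def exp_minus field_simps flip: exp_double exp_add)
  have "(X_tilde b X)\<^sup>2 = r\<^sup>2 * (1 + X\<^sup>2) - 1"
    using X by (simp add: X_tilde_def r(1))
  moreover have "Y_tilde a b X Y = r * u" by (simp add: Y_tilde_def r_def u_def)
  ultimately have "sol_tilde a A B (X_tilde b X) (Y_tilde a b X Y)
      = a * (r * u)\<^sup>2 + A * (r * u) + (r\<^sup>2 * (1 + X\<^sup>2) - 1) + B"
    by (simp add: sol_tilde_def)
  also have "\<dots> = exp (- b) * sol a b A B X Y"
    unfolding sol_shear[OF a] u_def[symmetric] using r(4)
    by (simp add: sol_tilde_def J1_def J2_def r(1-3) field_simps power2_eq_square)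
  finally show ?thesis .
qed

section \<open>The free particle and the final statement\<close>

text \<open>\<open>W - (m Z + c)\<close> is the conic times the nonzero factor
  \<open>- m / (2 \<gamma> Yt)\<close>; comparing coefficients yields \<open>A_const\<close> and
  \<open>B_const\<close>.\<close>

lemma free_particle_sol:
  assumes "lam * \<gamma> \<noteq> 0" "m \<noteq> 0" "Yt \<noteq> 0"
  shows "W_free \<gamma> \<delta> lam Yt = m * Z_free a \<gamma> Xt Yt + c \<longleftrightarrow>
    sol_tilde a (A_const \<gamma> \<delta> lam m c) (B_const lam m) Xt Yt = 0"
proof -
  have n: "lam \<noteq> 0" "\<gamma> \<noteq> 0" using assms by auto
  have "W_free \<gamma> \<delta> lam Yt - (m * Z_free a \<gamma> Xt Yt + c) =
      - (m / (2 * \<gamma> * Yt)) * sol_tilde a (A_const \<gamma> \<delta> lam m c) (B_const lam m) Xt Yt"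
    using n assms(2,3)
    by (simp add: W_free_def Z_free_def sol_tilde_def A_const_def B_const_def field_simps
        power2_eq_square)
  moreover have "m / (2 * \<gamma> * Yt) \<noteq> 0" using n assms by simp
  ultimately show ?thesis
    by (metis eq_iff_diff_eq_0 mult_eq_0_iff neg_equal_0_iff_equal)
qed

text \<open>A general solution by itself fixes its constants only up to reparametrization. The third
  conjunct pins them down, with the same \<open>A\<close> and \<open>B\<close> on both sides of the
  point transformation, and the fourth ties them to \<open>m\<close> and \<open>c\<close>.\<close>

theorem mainTheorem1:
  fixes a b \<gamma> \<delta> lam :: real
  assumes "a \<noteq> 0" and "lam * \<gamma> \<noteq> 0"
  shows
    "general_solution (ode a b) (sol a b)
        {\<lambda>X. k - b / (3 * a) * X |k. True}
        {(X, Y, p). X \<noteq> 0 \<and> p \<noteq> - b / (3 * a)}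
     \<and> general_solution (ode_tilde a) (sol_tilde a)
        {\<lambda>X. k |k. True}
        {(X, Y, p). X \<noteq> 0 \<and> p \<noteq> 0}
     \<and> (\<forall>I Y Yt. open_interval I \<longrightarrow>
          I \<subseteq> {X. X \<noteq> 0 \<and> exp (- b) * (1 + X ^ 2) > 1} \<longrightarrow>
          (\<forall>X\<in>I. Yt (X_tilde b X) = Y_tilde a b X (Y X)) \<longrightarrow>
          (solves_ode2 (ode a b) I Y \<longleftrightarrow> solves_ode2 (ode_tilde a) (X_tilde b ` I) Yt)
          \<and> (\<forall>A B. implicit_on (sol a b A B) I Y \<longleftrightarrow>
                   implicit_on (sol_tilde a A B) (X_tilde b ` I) Yt))
     \<and> (\<forall>m c Xt Yt. m \<noteq> 0 \<longrightarrow> Yt \<noteq> 0 \<longrightarrow>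
          (W_free \<gamma> \<delta> lam Yt = m * Z_free a \<gamma> Xt Yt + c \<longleftrightarrow>
           sol_tilde a (A_const \<gamma> \<delta> lam m c) (B_const lam m) Xt Yt = 0))"
proof (intro conjI allI impI)
  show "general_solution (ode a b) (sol a b)
      {\<lambda>X. k - b / (3 * a) * X |k. True} {(X, Y, p). X \<noteq> 0 \<and> p \<noteq> - b / (3 * a)}"
    using assms(1) by (rule general_solution_ode)
  show "general_solution (ode_tilde a) (sol_tilde a)
      {\<lambda>X. k |k. True} {(X, Y, p). X \<noteq> 0 \<and> p \<noteq> 0}"
    using assms(1) by (rule general_solution_ode_tilde)
next
  fix I Y Yt
  assume I: "open_interval I" "I \<subseteq> {X. X \<noteq> 0 \<and> exp (- b) * (1 + X ^ 2) > 1}"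
    and Yt: "\<forall>X\<in>I. Yt (X_tilde b X) = Y_tilde a b X (Y X)"
  show "solves_ode2 (ode a b) I Y \<longleftrightarrow> solves_ode2 (ode_tilde a) (X_tilde b ` I) Yt"
    using point_transformation_solves[OF assms(1) I] Yt by blast
  fix A B
  have "sol_tilde a A B (X_tilde b X) (Yt (X_tilde b X)) = exp (- b) * sol a b A B X (Y X)"
    if "X \<in> I" for X
    using point_transformation_sol[OF assms(1)] Yt I(2) that by auto
  then show "implicit_on (sol a b A B) I Y \<longleftrightarrow>
      implicit_on (sol_tilde a A B) (X_tilde b ` I) Yt"
    by (simp add: implicit_on_def)
next
  fix m c Xt Yt :: real
  assume "m \<noteq> 0" "Yt \<noteq> 0"
  then show "W_free \<gamma> \<delta> lam Yt = m * Z_free a \<gamma> Xt Yt + c \<longleftrightarrow>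
      sol_tilde a (A_const \<gamma> \<delta> lam m c) (B_const lam m) Xt Yt = 0"
    by (rule free_particle_sol[OF assms(2)])
qed

end
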